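(* Let $(T(t))_{t\ge0}$ be a $C_0$-semigroup on a Banach space $X$ with generator $A$, and let $K:[0,\infty)\times X\to X$ be collectively compact and continuous separately in both variables. Assume that for every $x_0\in X$ there exists a unique global solution $x(\cdot,x_0)\in C([0,\infty),X)$ of $$x(t,x_0)=T(t)x_0+\int_0^tT(t-s)K(s,x(s,x_0))\,ds,\qquad t\ge0,$$ and that the map $x:[0,\infty)\times X\to X$ is continuous separately in both variables. Assume moreover that for every bounded set $B\subset X$ and every $t_0>0$ the set $\{x(t,x_0):\ 0\le t\le t_0,\ x_0\in B\}$ is bounded. Let $a:[0,\infty)\to[0,\infty)$ be a non-increasing function with $\lim_{t\to\infty}a(t)=0$, and let $L\subset[0,\infty)$ be unbounded. Then the set $$\bigl\{y\in X:\ \text{there are infinitely many } t_n\in L\text{ with }\|x(t_n,y)\|\ge a(t_n)\|T(t_n)\|_\mu\bigr\}$$ is residual in $X$.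
   Context: All Banach spaces are complex and infinite-dimensional. $K$ is collectively compact if $K([0,t_0]\times B)$ is precompact in $X$ for each bounded set $B\subset X$ and each $t_0\ge0$. For $S\in B(X)$, $\|S\|_\mu=\inf\{\|S\upharpoonright_M\|:\ M\subset X\text{ a closed subspace},\ \operatorname{codim}M<\infty\}$. A set is residual if it contains a dense $G_\delta$ set. *)

theory Defs
  imports "HOL-Analysis.Analysis"
begin

section \<open>Complex Banach spaces\<close>

class complex_normed_vector = real_normed_vector +
  fixes scaleC :: "complex \<Rightarrow> 'a \<Rightarrow> 'a"  (infixr \<open>*\<^sub>C\<close> 75)
  assumes scaleC_add_right: "c *\<^sub>C (x + y) = c *\<^sub>C x + c *\<^sub>C y"
    and scaleC_add_left: "(c + d) *\<^sub>C x = c *\<^sub>C x + d *\<^sub>C x"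
    and scaleC_scaleC: "c *\<^sub>C (d *\<^sub>C x) = (c * d) *\<^sub>C x"
    and scaleR_scaleC: "r *\<^sub>R x = complex_of_real r *\<^sub>C x"
    and norm_scaleC: "norm (c *\<^sub>C x) = cmod c * norm x"

class complex_banach = complex_normed_vector + banach

instantiation complex :: complex_banach
begin

definition scaleC_complex :: "complex \<Rightarrow> complex \<Rightarrow> complex"
  where "scaleC_complex c x = c * x"

instance
  by standard (auto simp: scaleC_complex_def algebra_simps norm_mult scaleR_conv_of_real)

end

global_interpretation complex_vector: vector_space
  "scaleC :: complex \<Rightarrow> 'a \<Rightarrow> 'a :: complex_normed_vector"
  defines csubspace = complex_vector.subspace
    and cspan = complex_vector.span
proof
  fix x :: 'a
  show "1 *\<^sub>C x = x"
    using scaleR_scaleC[of 1 x] by simp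
qed (simp_all add: scaleC_add_right scaleC_add_left scaleC_scaleC)

text \<open>\<open>bounded_clinear S\<close> says that \<open>S\<close> belongs to \<open>B(X)\<close>; boundedness and additivity come from
  the real-linear library notion.\<close>

definition bounded_clinear :: "('a::complex_normed_vector \<Rightarrow> 'a) \<Rightarrow> bool"
  where "bounded_clinear S \<longleftrightarrow> bounded_linear S \<and> (\<forall>c x. S (c *\<^sub>C x) = c *\<^sub>C S x)"

text \<open>\<open>dim X/M < \<infinity>\<close>: the classes of finitely many vectors span the quotient.\<close>

definition finite_codim :: "'a::complex_normed_vector set \<Rightarrow> bool"
  where "finite_codim M \<longleftrightarrow> (\<exists>F. finite F \<and> cspan (M \<union> F) = UNIV)"

definition infinite_dimensional :: "'a::complex_normed_vector itself \<Rightarrow> bool"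
  where "infinite_dimensional _ \<longleftrightarrow> (\<nexists>F :: 'a set. finite F \<and> cspan F = UNIV)"

text \<open>For \<open>S \<in> B(X)\<close> and a subspace \<open>M\<close> this is the norm of the restriction \<open>M \<rightarrow> X\<close>; the set over
  which the supremum is taken is bounded and contains the value at \<open>0\<close>.\<close>

definition restr_norm :: "('a::complex_normed_vector \<Rightarrow> 'a) \<Rightarrow> 'a set \<Rightarrow> real"
  where "restr_norm S M = (SUP x\<in>{x\<in>M. norm x \<le> 1}. norm (S x))"

definition mu_norm :: "('a::complex_normed_vector \<Rightarrow> 'a) \<Rightarrow> real"
  where "mu_norm S = (INF M\<in>{M. csubspace M \<and> closed M \<and> finite_codim M}. restr_norm S M)"

section \<open>Semigroups and mild solutions\<close>

text \<open>Functions of time are total on \<^typ>\<open>real\<close>, but only their values on \<open>[0,\<infinity>)\<close> are constrained.\<close>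

definition C0_semigroup :: "(real \<Rightarrow> 'a::complex_banach \<Rightarrow> 'a) \<Rightarrow> bool"
  where "C0_semigroup T \<longleftrightarrow>
    (\<forall>t\<ge>0. bounded_clinear (T t)) \<and>
    (\<forall>x. T 0 x = x) \<and>
    (\<forall>s\<ge>0. \<forall>t\<ge>0. \<forall>x. T (s + t) x = T s (T t x)) \<and>
    (\<forall>x. continuous_on {0..} (\<lambda>t. T t x))"

text \<open>The generator, an unbounded operator in general, is represented by its graph.\<close>

definition generator :: "(real \<Rightarrow> 'a::complex_banach \<Rightarrow> 'a) \<Rightarrow> ('a \<times> 'a) set"
  where "generator T = {(x, y). ((\<lambda>h. (T h x - x) /\<^sub>R h) \<longlongrightarrow> y) (at_right 0)}"

definition collectively_compact :: "(real \<Rightarrow> 'a::complex_banach \<Rightarrow> 'a) \<Rightarrow> bool"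
  where "collectively_compact K \<longleftrightarrow>
    (\<forall>B. bounded B \<longrightarrow> (\<forall>t\<^sub>0\<ge>0. compact (closure ((\<lambda>(t, x). K t x) ` ({0..t\<^sub>0} \<times> B)))))"

definition separately_continuous :: "(real \<Rightarrow> 'a::complex_banach \<Rightarrow> 'a) \<Rightarrow> bool"
  where "separately_continuous f \<longleftrightarrow>
    (\<forall>x. continuous_on {0..} (\<lambda>t. f t x)) \<and> (\<forall>t\<ge>0. continuous_on UNIV (f t))"

text \<open>
  The library's Bochner integral requires a second countable (here: separable) codomain, so the
  integral is the Henstock--Kurzweil one, which is available in every Banach space. For a
  \<open>C\<^sub>0\<close>-semigroup \<open>T\<close>, a collectively compact, separately continuous \<open>K\<close> and a continuous \<open>u\<close>
  the integrand is strongly measurable and bounded, hence Bochner integrable, and both integrals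
  agree. Writing \<open>has_integral\<close> makes the existence of the integral part of the equation.
\<close>

definition mild_solution ::
    "(real \<Rightarrow> 'a::complex_banach \<Rightarrow> 'a) \<Rightarrow> (real \<Rightarrow> 'a \<Rightarrow> 'a) \<Rightarrow> 'a \<Rightarrow> (real \<Rightarrow> 'a) \<Rightarrow> bool"
  where "mild_solution T K x\<^sub>0 u \<longleftrightarrow>
    continuous_on {0..} u \<and>
    (\<forall>t\<ge>0. ((\<lambda>s. T (t - s) (K s (u s))) has_integral (u t - T t x\<^sub>0)) {0..t})"

definition residual :: "'a::topological_space set \<Rightarrow> bool"
  where "residual S \<longleftrightarrow> (\<exists>G. gdelta G \<and> closure G = UNIV \<and> G \<subseteq> S)"

end

theory Submission
  imports Defs
begin

text \<open>
  The nonlinear flow is a compact perturbation of the semigroup: \<open>x(t,y) = T(t)y + C\<^sub>t(y)\<close>, where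
  \<open>C\<^sub>t\<close> is the integral term, and \<open>C\<^sub>t\<close> maps bounded sets to precompact sets. Indeed, for \<open>y\<close> in a
  bounded set the values \<open>K(s,x(s,y))\<close>, \<open>s \<le> t\<close>, stay in a precompact set; the strongly continuous
  family \<open>T(\<tau>)\<close>, \<open>\<tau> \<le> t\<close>, keeps it precompact; and integration over \<open>[0,t]\<close> stays within \<open>t\<close> times
  the closed convex hull (\<open>compact_closure_mild_solution_minus_semigroup\<close>).

  The quantity \<open>\<parallel>S\<parallel>\<^sub>\<mu>\<close> does not see compact sets. If the image of a ball of radius \<open>e\<close> under
  \<open>S + R\<close> lies in a ball of radius \<open>b\<close> around \<open>0\<close> and \<open>R\<close> maps that ball to a precompact set, then
  \<open>S\<close> maps it into finitely many balls of radius slightly above \<open>b\<close>. Functionals that norm the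
  centres of these balls cut out a closed subspace of finite codimension on which \<open>S\<close> is bounded by
  about \<open>2b/e\<close>, so that \<open>e \<parallel>S\<parallel>\<^sub>\<mu> \<le> 2b\<close> (\<open>mu_norm_le_compact_perturbation\<close>).

  Consequently, when \<open>a(t) < e/2\<close> and \<open>\<parallel>T(t)\<parallel>\<^sub>\<mu> > 0\<close>, every ball of radius \<open>e\<close> contains a point \<open>y\<close>
  with \<open>\<parallel>x(t,y)\<parallel> > a(t) \<parallel>T(t)\<parallel>\<^sub>\<mu>\<close>. For each \<open>n\<close> the points that satisfy this strict inequality for
  some \<open>t > n\<close> in \<open>L\<close> thus form a dense set, which is open because \<open>x(t,\<cdot>)\<close> is continuous, and the
  Baire category theorem applies to the intersection over \<open>n\<close>. The remaining case, where
  \<open>\<parallel>T(t)\<parallel>\<^sub>\<mu> = 0\<close> for infinitely many \<open>t \<in> L\<close>, is trivial, since every \<open>y\<close> then qualifies.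

  Norming functionals come from the Hahn--Banach theorem and the local boundedness of the semigroup
  from the uniform boundedness principle; both are proved here.
\<close>

section \<open>Norming functionals\<close>

definition sublinear :: "('a::real_vector \<Rightarrow> real) \<Rightarrow> bool"
  where "sublinear p \<longleftrightarrow> (\<forall>x y. p (x + y) \<le> p x + p y) \<and> (\<forall>c>0. \<forall>x. p (c *\<^sub>R x) \<le> c * p x)"

lemma sublinear_add: "sublinear p \<Longrightarrow> p (x + y) \<le> p x + p y"
  and sublinear_scale_le: "sublinear p \<Longrightarrow> c > 0 \<Longrightarrow> p (c *\<^sub>R x) \<le> c * p x"
  by (auto simp: sublinear_def)

lemma sublinear_scale:
  assumes "sublinear p" "c > 0"
  shows "p (c *\<^sub>R x) = c * p x"
proof (rule antisym)
  have "p ((1 / c) *\<^sub>R c *\<^sub>R x) \<le> (1 / c) * p (c *\<^sub>R x)"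
    using assms by (intro sublinear_scale_le) auto
  then show "c * p x \<le> p (c *\<^sub>R x)"
    using \<open>c > 0\<close> by (simp add: field_simps)
qed (use assms sublinear_scale_le in blast)

lemma sublinear_0: "sublinear p \<Longrightarrow> p 0 = 0"
  using sublinear_scale[of p 2 0] by simp

lemma sublinear_minus: "sublinear p \<Longrightarrow> - p (- x) \<le> p x"
  using sublinear_add[of p x "- x"] sublinear_0[of p] by simp

lemma sublinear_norm: "sublinear norm"
  by (simp add: sublinear_def norm_triangle_ineq)

text \<open>
  The largest sublinear functional below \<open>p\<close> that is linear along the ray through \<open>y\<close> in the
  sense of \<open>q (- y) = - p y\<close>. It serves twice: a minimal sublinear functional equals all its
  shifts and is therefore additive, and shifting the norm by \<open>z\<close> forces every
  linear functional below the result to attain \<open>norm z\<close> at \<open>z\<close>.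
\<close>

definition shift_sublinear :: "('a::real_vector \<Rightarrow> real) \<Rightarrow> 'a \<Rightarrow> 'a \<Rightarrow> real"
  where "shift_sublinear p y x = (INF t\<in>{0..}. p (x + t *\<^sub>R y) - t * p y)"

lemma shift_sublinear_lower:
  assumes "sublinear p" "t \<ge> 0"
  shows "- p (- x) \<le> p (x + t *\<^sub>R y) - t * p y"
proof -
  have "t * p y = p (t *\<^sub>R y)"
    using assms sublinear_scale[of p t y] sublinear_0[of p] by (cases "t = 0") auto
  also have "\<dots> \<le> p (x + t *\<^sub>R y) + p (- x)"
    using sublinear_add[OF assms(1), of "x + t *\<^sub>R y" "- x"] by simp
  finally show ?thesis by simp
qed

lemma shift_sublinear_le:
  assumes "sublinear p" "t \<ge> 0"
  shows "shift_sublinear p y x \<le> p (x + t *\<^sub>R y) - t * p y"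
  unfolding shift_sublinear_def
  using shift_sublinear_lower[OF assms(1)] assms(2)
  by (intro cINF_lower bdd_belowI2[of _ "- p (- x)"]) auto

lemma sublinear_shift_sublinear:
  assumes p: "sublinear p"
  shows "sublinear (shift_sublinear p y)"
  unfolding sublinear_def
proof (intro conjI allI impI)
  fix u v :: 'a
  have key: "shift_sublinear p y (u + v) \<le> (p (u + s *\<^sub>R y) - s * p y) + (p (v + t *\<^sub>R y) - t * p y)"
    if "s \<ge> 0" "t \<ge> 0" for s t
  proof -
    have "shift_sublinear p y (u + v) \<le> p ((u + v) + (s + t) *\<^sub>R y) - (s + t) * p y"
      using that by (intro shift_sublinear_le[OF p]) auto
    also have "(u + v) + (s + t) *\<^sub>R y = (u + s *\<^sub>R y) + (v + t *\<^sub>R y)"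
      by (simp add: algebra_simps)
    also have "p \<dots> \<le> p (u + s *\<^sub>R y) + p (v + t *\<^sub>R y)"
      by (rule sublinear_add[OF p])
    finally show ?thesis by (simp add: algebra_simps)
  qed
  have "shift_sublinear p y (u + v) - (p (u + s *\<^sub>R y) - s * p y) \<le> shift_sublinear p y v"
    if "s \<ge> 0" for s
    unfolding shift_sublinear_def[of p y v] using key[OF that] by (intro cINF_greatest) (auto simp: algebra_simps)
  then have "shift_sublinear p y (u + v) - shift_sublinear p y v \<le> shift_sublinear p y u"
    unfolding shift_sublinear_def[of p y u] by (intro cINF_greatest) (auto simp: algebra_simps)
  then show "shift_sublinear p y (u + v) \<le> shift_sublinear p y u + shift_sublinear p y v"
    by simp
next
  fix c :: real and u :: 'a
  assume c: "c > 0"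
  have "shift_sublinear p y (c *\<^sub>R u) / c \<le> p (u + t *\<^sub>R y) - t * p y" if "t \<ge> 0" for t
  proof -
    have "shift_sublinear p y (c *\<^sub>R u) \<le> p (c *\<^sub>R u + (c * t) *\<^sub>R y) - (c * t) * p y"
      using that c by (intro shift_sublinear_le[OF p]) auto
    also have "c *\<^sub>R u + (c * t) *\<^sub>R y = c *\<^sub>R (u + t *\<^sub>R y)"
      by (simp add: algebra_simps)
    also have "p \<dots> = c * p (u + t *\<^sub>R y)"
      by (rule sublinear_scale[OF p c])
    finally show ?thesis using c by (simp add: field_simps)
  qed
  then have "shift_sublinear p y (c *\<^sub>R u) / c \<le> shift_sublinear p y u"
    unfolding shift_sublinear_def[of p y u] by (intro cINF_greatest) auto
  then show "shift_sublinear p y (c *\<^sub>R u) \<le> c * shift_sublinear p y u"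
    using c by (simp add: field_simps)
qed

text \<open>
  By minimality \<open>q\<close> is its own shift by \<open>y\<close>, and the term with \<open>t = 1\<close> in the infimum then reads
  \<open>q x \<le> q (x + y) - q y\<close>, the converse of subadditivity.
\<close>

lemma minimal_sublinear_imp_linear:
  assumes q: "sublinear q" and min: "\<And>r. sublinear r \<Longrightarrow> (\<And>x. r x \<le> q x) \<Longrightarrow> r = q"
  shows "linear q"
proof -
  have le: "q x \<le> q (x + y) - q y" for x y
  proof -
    have "shift_sublinear q y = q"
      using shift_sublinear_le[OF q, of 0 y] by (intro min sublinear_shift_sublinear[OF q]) simp
    then show ?thesis
      using shift_sublinear_le[OF q, of 1 y x] by simp
  qed
  have add: "q (x + y) = q x + q y" for x y
    using le[of x y] sublinear_add[OF q, of x y] by simp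
  have minus: "q (- x) = - q x" for x
    using add[of x "- x"] sublinear_0[OF q] by simp
  have scale: "q (c *\<^sub>R x) = c * q x" for c x
  proof -
    consider "c > 0" | "c = 0" | "- c > 0" by linarith
    then show ?thesis
    proof cases
      case 3
      from sublinear_scale[OF q 3, of x] show ?thesis by (simp add: minus)
    qed (use q in \<open>auto simp: sublinear_scale sublinear_0\<close>)
  qed
  show ?thesis by (rule linearI) (simp_all add: add scale)
qed

text \<open>
  Provides the lower bounds for Zorn's lemma. The infimum is finite because
  \<open>q x \<ge> - q (- x) \<ge> - p (- x)\<close>. In the proof of subadditivity, the minima for \<open>u\<close> and for \<open>v\<close> may
  be approached along different members of the chain; the smaller of two members serves both.
\<close>

lemma sublinear_Inf_chain:
  assumes ne: "C \<noteq> {}" and sub: "\<And>q. q \<in> C \<Longrightarrow> sublinear q" and le: "\<And>q x. q \<in> C \<Longrightarrow> q x \<le> p x"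
    and chain: "\<And>q r. q \<in> C \<Longrightarrow> r \<in> C \<Longrightarrow> q \<le> r \<or> r \<le> q"
  shows "sublinear (\<lambda>x. INF q\<in>C. q x)" and "\<And>q x. q \<in> C \<Longrightarrow> (INF q\<in>C. q x) \<le> q x"
proof -
  have bdd: "bdd_below ((\<lambda>q. q x) ` C)" for x
  proof (rule bdd_belowI2)
    fix q assume "q \<in> C"
    then show "- p (- x) \<le> q x"
      using sublinear_minus[OF sub, of q x] le[of q "- x"] by simp
  qed
  show low: "(INF q\<in>C. q x) \<le> q x" if "q \<in> C" for q x
    using that by (intro cINF_lower bdd)
  show "sublinear (\<lambda>x. INF q\<in>C. q x)"
    unfolding sublinear_def
  proof (intro conjI allI impI)
    fix u v
    have key: "(INF q\<in>C. q (u + v)) \<le> q u + r v" if qr: "q \<in> C" "r \<in> C" for q r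
    proof -
      obtain s where s: "s \<in> C" "s \<le> q" "s \<le> r"
        using chain[OF qr] qr by blast
      have "(INF q\<in>C. q (u + v)) \<le> s (u + v)" by (rule low[OF s(1)])
      also have "\<dots> \<le> s u + s v" by (rule sublinear_add[OF sub[OF s(1)]])
      also have "\<dots> \<le> q u + r v" using s by (intro add_mono) (auto simp: le_fun_def)
      finally show ?thesis .
    qed
    have "(INF q\<in>C. q (u + v)) - q u \<le> (INF r\<in>C. r v)" if "q \<in> C" for q
      using key[OF that] ne by (intro cINF_greatest) (auto simp: algebra_simps)
    then have "(INF q\<in>C. q (u + v)) - (INF r\<in>C. r v) \<le> (INF q\<in>C. q u)"
      using ne by (intro cINF_greatest) (auto simp: algebra_simps)
    then show "(INF q\<in>C. q (u + v)) \<le> (INF q\<in>C. q u) + (INF q\<in>C. q v)"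
      by simp
  next
    fix c :: real and u assume c: "c > 0"
    have "(INF q\<in>C. q (c *\<^sub>R u)) / c \<le> q u" if "q \<in> C" for q
      using low[OF that, of "c *\<^sub>R u"] sublinear_scale[OF sub[OF that] c, of u] c
      by (simp add: field_simps)
    then have "(INF q\<in>C. q (c *\<^sub>R u)) / c \<le> (INF q\<in>C. q u)"
      using ne by (intro cINF_greatest) auto
    then show "(INF q\<in>C. q (c *\<^sub>R u)) \<le> c * (INF q\<in>C. q u)"
      using c by (simp add: field_simps)
  qed
qed

text \<open>
  The Hahn--Banach theorem. Instead of extending functionals from subspaces, the proof descends: a
  minimal element among the sublinear functionals below \<open>p\<close> exists by Zorn's lemma and is linear.
\<close>

lemma sublinear_dominates_linear:
  assumes p: "sublinear p"
  obtains f where "linear f" "\<And>x. f x \<le> p x"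
proof -
  define A where "A = {q. sublinear q \<and> q \<le> p}"
  have po: "partial_order_on A (relation_of (\<lambda>q r. r \<le> q) A)"
    by (auto simp: partial_order_on_def preorder_on_def refl_on_def trans_def antisym_def relation_of_def)
  have ub: "\<exists>u\<in>A. \<forall>q\<in>C. u \<le> q" if C: "C \<in> Chains (relation_of (\<lambda>q r. r \<le> q) A)" for C
  proof (cases "C = {}")
    case True
    then show ?thesis using p by (auto simp: A_def)
  next
    case False
    have CA: "sublinear q" "q x \<le> p x" if "q \<in> C" for q x
      using C that by (auto simp: Chains_def relation_of_def A_def le_fun_def)
    have ch: "q \<le> r \<or> r \<le> q" if "q \<in> C" "r \<in> C" for q r
      using C that by (auto simp: Chains_def relation_of_def)
    define u where "u = (\<lambda>x. INF q\<in>C. q x)"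
    have u: "sublinear u" "\<And>q. q \<in> C \<Longrightarrow> u \<le> q"
      using sublinear_Inf_chain[where C = C and p = p] False CA ch by (auto simp: u_def le_fun_def)
    then have "u \<le> p"
      using False CA by (meson ex_in_conv le_funI order_trans)
    then show ?thesis using u by (auto simp: A_def)
  qed
  obtain f where f: "f \<in> A" and min: "\<And>r. r \<in> A \<Longrightarrow> r \<le> f \<Longrightarrow> r = f"
    using predicate_Zorn[OF po ub] by blast
  have "linear f"
  proof (rule minimal_sublinear_imp_linear)
    fix r assume "sublinear r" "\<And>x. r x \<le> f x"
    then show "r = f"
      using f by (intro min) (auto simp: A_def le_fun_def intro: order_trans)
  qed (use f in \<open>simp add: A_def\<close>)
  then show thesis
    using f by (intro that) (auto simp: A_def le_fun_def)
qed

lemma norming_functional: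
  fixes z :: "'a::real_normed_vector"
  obtains f :: "'a \<Rightarrow> real" where "bounded_linear f" "\<And>x. \<bar>f x\<bar> \<le> norm x" "f z = norm z"
proof -
  obtain f where f: "linear f" and le: "\<And>x. f x \<le> shift_sublinear norm z x"
    using sublinear_dominates_linear[OF sublinear_shift_sublinear[OF sublinear_norm]] by blast
  have le_norm: "f x \<le> norm x" for x
    using le[of x] shift_sublinear_le[OF sublinear_norm, of 0 z x] by simp
  have abs_le: "\<bar>f x\<bar> \<le> norm x" for x
    using le_norm[of x] le_norm[of "- x"] by (simp add: linear_neg[OF f])
  have "f (- z) \<le> - norm z"
    using le[of "- z"] shift_sublinear_le[OF sublinear_norm, of 1 z "- z"] by simp
  then have "f z = norm z"
    using le_norm[of z] by (simp add: linear_neg[OF f])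
  moreover have "bounded_linear f"
    using f abs_le by (intro bounded_linear_intro[where K = 1]) (auto simp: linear_add linear_scale)
  ultimately show thesis using abs_le that by blast
qed

section \<open>Finite codimension and the norm modulo finite codimension\<close>

lemma finite_codim_UNIV: "finite_codim UNIV"
  unfolding finite_codim_def
  using complex_vector.span_superset by (intro exI[of _ "{}"]) fastforce

text \<open>
  A vector \<open>m\<close> of \<open>M\<close> outside the kernel, if there is one, spans \<open>M\<close> modulo the kernel, so that
  adding \<open>m\<close> to the finite set of complementary vectors compensates for passing to the kernel.
\<close>

lemma finite_codim_Int_kernel:
  fixes g :: "'a::complex_normed_vector \<Rightarrow> complex"
  assumes M: "csubspace M" "finite_codim M"
    and add: "\<And>x y. g (x + y) = g x + g y" and scale: "\<And>c x. g (c *\<^sub>C x) = c * g x"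
  shows "finite_codim (M \<inter> {x. g x = 0})"
proof (cases "\<forall>m\<in>M. g m = 0")
  case True
  then have "M \<inter> {x. g x = 0} = M" by auto
  then show ?thesis using M by simp
next
  case False
  let ?N = "M \<inter> {x. g x = 0}"
  obtain m where m: "m \<in> M" "g m \<noteq> 0" using False by auto
  obtain F where F: "finite F" "cspan (M \<union> F) = UNIV"
    using M by (auto simp: finite_codim_def)
  let ?S = "cspan (?N \<union> insert m F)"
  have minus: "g (x - y) = g x - g y" for x y
    using add[of "x - y" y] by simp
  have "x \<in> ?S" if "x \<in> M" for x
  proof -
    let ?c = "g x / g m"
    have "x - ?c *\<^sub>C m \<in> ?N"
      using that m M by (auto simp: complex_vector.subspace_diff complex_vector.subspace_scale minus scale)
    then have "x - ?c *\<^sub>C m \<in> ?S" by (intro complex_vector.span_base) auto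
    moreover have "?c *\<^sub>C m \<in> ?S"
      by (intro complex_vector.span_scale complex_vector.span_base) auto
    ultimately have "(x - ?c *\<^sub>C m) + ?c *\<^sub>C m \<in> ?S" by (rule complex_vector.span_add)
    then show ?thesis by simp
  qed
  moreover have "x \<in> ?S" if "x \<in> F" for x
    using that by (intro complex_vector.span_base) auto
  ultimately have "cspan (M \<union> F) \<subseteq> ?S"
    by (intro complex_vector.span_minimal) auto
  then show ?thesis
    unfolding finite_codim_def using F by (intro exI[of _ "insert m F"]) auto
qed

text \<open>
  A real functional \<open>h\<close> is the real part of the complex functional \<open>x \<mapsto> h x - \<i> h (\<i> x)\<close>, whose
  kernel is a complex subspace inside the kernel of \<open>h\<close>.
\<close>

lemma finite_codim_real_functionals:
  fixes h :: "'i \<Rightarrow> 'a::complex_normed_vector \<Rightarrow> real"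
  assumes "finite I" and h: "\<And>i. i \<in> I \<Longrightarrow> bounded_linear (h i)"
  obtains M where "csubspace M" "closed M" "finite_codim M" "\<And>i x. i \<in> I \<Longrightarrow> x \<in> M \<Longrightarrow> h i x = 0"
proof -
  have "\<exists>M. csubspace M \<and> closed M \<and> finite_codim M \<and> (\<forall>i\<in>I. \<forall>x\<in>M. h i x = 0)"
    using assms
  proof (induction I)
    case empty
    show ?case
      using finite_codim_UNIV by (intro exI[of _ UNIV]) simp
  next
    case (insert i I)
    then obtain M where M: "csubspace M" "closed M" "finite_codim M" "\<forall>i\<in>I. \<forall>x\<in>M. h i x = 0"
      by auto
    interpret h: bounded_linear "h i" using insert by simp
    have scaleC_i: "bounded_linear (\<lambda>x::'a. \<i> *\<^sub>C x)"
      by (rule bounded_linear_intro[where K = 1])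
        (auto simp: scaleC_add_right scaleR_scaleC scaleC_scaleC norm_scaleC mult.commute)
    define g where "g x = complex_of_real (h i x) - \<i> * complex_of_real (h i (\<i> *\<^sub>C x))" for x
    have hg: "h i x = Re (g x)" for x by (simp add: g_def)
    have add: "g (x + y) = g x + g y" for x y
      by (simp add: g_def scaleC_add_right h.add algebra_simps)
    have scale: "g (c *\<^sub>C x) = c * g x" for c x
    proof -
      have 1: "c *\<^sub>C x = Re c *\<^sub>R x + Im c *\<^sub>R \<i> *\<^sub>C x"
        by (simp add: scaleR_scaleC scaleC_scaleC scaleC_add_left[symmetric] complex_eq_iff)
      have 2: "\<i> *\<^sub>C c *\<^sub>C x = Re c *\<^sub>R \<i> *\<^sub>C x - Im c *\<^sub>R x"
      proof -
        have "\<i> *\<^sub>C c *\<^sub>C x + Im c *\<^sub>R x = Re c *\<^sub>R \<i> *\<^sub>C x"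
          by (simp add: scaleR_scaleC scaleC_scaleC scaleC_add_left[symmetric] complex_eq_iff)
        then show ?thesis by (simp add: algebra_simps)
      qed
      show ?thesis
        unfolding g_def by (subst 1, subst 2) (simp add: h.add h.diff h.scaleR complex_eq_iff)
    qed
    let ?N = "M \<inter> {x. g x = 0}"
    have "continuous_on UNIV g"
      unfolding g_def using scaleC_i
      by (intro continuous_intros h.continuous_on bounded_linear.continuous_on[OF scaleC_i])
    then have "closed {x. g x = 0}"
      by (intro closed_Collect_eq continuous_on_const)
    moreover have "csubspace ?N"
    proof (intro complex_vector.subspace_inter[OF M(1)] complex_vector.subspaceI)
      show "0 \<in> {x. g x = 0}" by (simp add: g_def)
    qed (auto simp: add scale)
    moreover have "finite_codim ?N"
      by (rule finite_codim_Int_kernel[OF M(1,3) add scale])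
    ultimately show ?case
      using M by (intro exI[of _ ?N]) (auto simp: hg)
  qed
  then show thesis using that by blast
qed

lemma restr_norm_nonneg:
  assumes S: "bounded_linear S" and M: "csubspace M"
  shows "restr_norm S M \<ge> 0"
proof -
  obtain C where C: "\<And>x. norm (S x) \<le> norm x * C" "C > 0"
    using bounded_linear.pos_bounded[OF S] by blast
  have "norm (S 0) \<le> restr_norm S M"
    unfolding restr_norm_def
  proof (rule cSUP_upper)
    show "bdd_above ((\<lambda>x. norm (S x)) ` {x \<in> M. norm x \<le> 1})"
    proof (rule bdd_aboveI2)
      fix x assume "x \<in> {x \<in> M. norm x \<le> 1}"
      then have "norm x * C \<le> 1 * C" using C by (intro mult_right_mono) auto
      then show "norm (S x) \<le> C" using C(1)[of x] by simp
    qed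
  qed (use complex_vector.subspace_0[OF M] in simp)
  then show ?thesis using norm_ge_zero order_trans by blast
qed

lemma mu_norm_le:
  assumes S: "bounded_linear S" and M: "csubspace M" "closed M" "finite_codim M"
    and bound: "\<And>x. x \<in> M \<Longrightarrow> norm x \<le> 1 \<Longrightarrow> norm (S x) \<le> r"
  shows "mu_norm S \<le> r"
proof -
  have "mu_norm S \<le> restr_norm S M"
    unfolding mu_norm_def using M restr_norm_nonneg[OF S]
    by (intro cINF_lower bdd_belowI2[of _ 0]) auto
  also have "\<dots> \<le> r"
    unfolding restr_norm_def using bound complex_vector.subspace_0[OF M(1)]
    by (intro cSUP_least) force+
  finally show ?thesis .
qed

lemma mu_norm_nonneg:
  assumes "bounded_linear S"
  shows "mu_norm S \<ge> 0"
  unfolding mu_norm_def using restr_norm_nonneg[OF assms] finite_codim_UNIV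
  by (intro cINF_greatest) (auto intro!: exI[of _ UNIV])

text \<open>
  Take for each centre \<open>z\<close> a norming functional \<open>f z\<close> and let \<open>M\<close> be a subspace on which all
  \<open>f z \<circ> S\<close> vanish. If \<open>x \<in> M\<close> lies in the unit ball and \<open>S x\<close> is within \<open>r\<close> of \<open>z\<close>, then
  \<open>norm z = f z (z - S x) \<le> r\<close>, hence \<open>norm (S x) \<le> 2 * r\<close>.
\<close>

lemma mu_norm_le_covering:
  assumes S: "bounded_linear S" and Z: "finite Z"
    and cover: "\<And>x. norm x \<le> 1 \<Longrightarrow> \<exists>z\<in>Z. norm (S x - z) \<le> r"
  shows "mu_norm S \<le> 2 * r"
proof -
  obtain f :: "'a \<Rightarrow> 'a \<Rightarrow> real" where
    f: "\<And>z. bounded_linear (f z)" "\<And>z x. \<bar>f z x\<bar> \<le> norm x" "\<And>z. f z z = norm z"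
    using norming_functional by metis
  have "bounded_linear (\<lambda>x. f z (S x))" for z
    by (rule bounded_linear_compose[OF f(1) S])
  then obtain M where M: "csubspace M" "closed M" "finite_codim M"
    and ker: "\<And>z x. z \<in> Z \<Longrightarrow> x \<in> M \<Longrightarrow> f z (S x) = 0"
    using finite_codim_real_functionals[OF Z, of "\<lambda>z x. f z (S x)"] by metis
  show ?thesis
  proof (rule mu_norm_le[OF S M])
    fix x assume x: "x \<in> M" "norm x \<le> 1"
    obtain z where z: "z \<in> Z" "norm (S x - z) \<le> r" using cover[OF x(2)] by blast
    have "norm z = - f z (S x - z)"
      using ker[OF z(1) x(1)] f(3)[of z] by (simp add: linear_diff[OF bounded_linear.linear[OF f(1)]])
    also have "\<dots> \<le> norm (S x - z)" using f(2)[of z "S x - z"] by linarith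
    finally have "norm z \<le> r" using z by simp
    then show "norm (S x) \<le> 2 * r"
      using z(2) norm_triangle_sub[of "S x" z] by simp
  qed
qed

section \<open>Precompact sets\<close>

lemma compact_closure_iff_finite_net:
  fixes Q :: "'a::complete_space set"
  shows "compact (closure Q) \<longleftrightarrow> (\<forall>e>0. \<exists>F. finite F \<and> (\<forall>q\<in>Q. \<exists>z\<in>F. dist z q < e))"
proof
  assume "compact (closure Q)"
  then have net: "\<forall>e>0. \<exists>F. finite F \<and> closure Q \<subseteq> (\<Union>z\<in>F. ball z e)"
    by (simp add: compact_eq_totally_bounded)
  show "\<forall>e>0. \<exists>F. finite F \<and> (\<forall>q\<in>Q. \<exists>z\<in>F. dist z q < e)"
  proof (intro allI impI)
    fix e :: real assume "e > 0"
    then obtain F where "finite F" "closure Q \<subseteq> (\<Union>z\<in>F. ball z e)" using net by blast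
    then show "\<exists>F. finite F \<and> (\<forall>q\<in>Q. \<exists>z\<in>F. dist z q < e)"
      using closure_subset[of Q] by (intro exI[of _ F]) fastforce
  qed
next
  assume net: "\<forall>e>0. \<exists>F. finite F \<and> (\<forall>q\<in>Q. \<exists>z\<in>F. dist z q < e)"
  have "\<exists>F. finite F \<and> closure Q \<subseteq> (\<Union>z\<in>F. ball z e)" if "e > 0" for e
  proof -
    obtain F where F: "finite F" "\<forall>q\<in>Q. \<exists>z\<in>F. dist z q < e / 2"
      using net \<open>e > 0\<close> by (meson half_gt_zero)
    have "Q \<subseteq> (\<Union>z\<in>F. cball z (e / 2))" using F(2) by fastforce
    moreover have "closed (\<Union>z\<in>F. cball z (e / 2))" using F(1) by auto
    ultimately have "closure Q \<subseteq> (\<Union>z\<in>F. cball z (e / 2))" by (rule closure_minimal)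
    also have "\<dots> \<subseteq> (\<Union>z\<in>F. ball z e)" using \<open>e > 0\<close> by fastforce
    finally show ?thesis using F(1) by blast
  qed
  then show "compact (closure Q)"
    by (simp add: compact_eq_totally_bounded complete_eq_closed)
qed

lemma compact_closure_if_near_compact:
  fixes Q :: "'a::complete_space set"
  assumes near: "\<And>e. e > 0 \<Longrightarrow> \<exists>C. compact C \<and> (\<forall>q\<in>Q. \<exists>c\<in>C. dist c q < e)"
  shows "compact (closure Q)"
  unfolding compact_closure_iff_finite_net
proof (intro allI impI)
  fix e :: real assume "e > 0"
  then obtain C where C: "compact C" "\<forall>q\<in>Q. \<exists>c\<in>C. dist c q < e / 2"
    using near[of "e / 2"] by auto
  have "compact (closure C)" using C(1) by (simp add: compact_imp_closed)
  then obtain F where F: "finite F" "\<forall>c\<in>C. \<exists>z\<in>F. dist z c < e / 2"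
    unfolding compact_closure_iff_finite_net using \<open>e > 0\<close> by (meson half_gt_zero)
  have "\<exists>z\<in>F. dist z q < e" if "q \<in> Q" for q
  proof -
    obtain c where c: "c \<in> C" "dist c q < e / 2" using C(2) \<open>q \<in> Q\<close> by blast
    obtain z where z: "z \<in> F" "dist z c < e / 2" using F(2) c(1) by blast
    have "dist z q < e" using dist_triangle[of z q c] c(2) z(2) by simp
    then show ?thesis using z(1) by blast
  qed
  then show "\<exists>F. finite F \<and> (\<forall>q\<in>Q. \<exists>z\<in>F. dist z q < e)" using F(1) by blast
qed

text \<open>
  Every Riemann sum divided by \<open>b - a\<close> is a convex combination of values of \<open>f\<close>.
\<close>

lemma has_integral_mean_in_convex:
  fixes f :: "real \<Rightarrow> 'a::real_normed_vector"
  assumes int: "(f has_integral i) {a..b}" and "a < b"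
    and C: "closed C" "convex C" and f: "\<And>s. s \<in> {a..b} \<Longrightarrow> f s \<in> C"
  shows "i /\<^sub>R (b - a) \<in> C"
  unfolding closed_approachable[OF C(1), symmetric]
proof (intro allI impI)
  fix e :: real assume "e > 0"
  then have "e * (b - a) > 0" using \<open>a < b\<close> by simp
  then obtain \<gamma> where \<gamma>: "gauge \<gamma>"
    "\<And>D. D tagged_division_of {a..b} \<Longrightarrow> \<gamma> fine D \<Longrightarrow>
       norm ((\<Sum>(x, k)\<in>D. measure lborel k *\<^sub>R f x) - i) < e * (b - a)"
    using int unfolding has_integral_real by metis
  obtain D where D: "D tagged_division_of {a..b}" "\<gamma> fine D"
    using fine_division_exists_real[OF \<gamma>(1)] by blast
  let ?w = "\<lambda>p. measure lborel (snd p) / (b - a)"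
  have "(\<Sum>p\<in>D. ?w p *\<^sub>R f (fst p)) \<in> C"
  proof (rule convex_sum[OF tagged_division_ofD(1)[OF D(1)] C(2)])
    have "(\<Sum>p\<in>D. measure lborel (snd p)) = b - a"
      using additive_content_tagged_division[of D a b] D(1) \<open>a < b\<close>
      by (simp add: case_prod_beta' box_real)
    then show "sum ?w D = 1"
      using \<open>a < b\<close> by (simp flip: sum_divide_distrib)
  next
    fix p assume "p \<in> D"
    then have "fst p \<in> {a..b}"
      using tagged_division_ofD(2,3)[OF D(1), of "fst p" "snd p"] by auto
    then show "f (fst p) \<in> C" by (rule f)
  qed (use \<open>a < b\<close> in auto)
  moreover have "(\<Sum>p\<in>D. ?w p *\<^sub>R f (fst p)) = (\<Sum>(x, k)\<in>D. measure lborel k *\<^sub>R f x) /\<^sub>R (b - a)"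
    by (simp add: scaleR_sum_right case_prod_beta' divide_inverse mult.commute)
  moreover have "dist ((\<Sum>(x, k)\<in>D. measure lborel k *\<^sub>R f x) /\<^sub>R (b - a)) (i /\<^sub>R (b - a)) < e"
    using \<gamma>(2)[OF D] \<open>a < b\<close>
    by (simp add: dist_norm flip: scaleR_diff_right) (simp add: field_simps)
  ultimately show "\<exists>y\<in>C. dist y (i /\<^sub>R (b - a)) < e" by metis
qed

text \<open>
  In essence Mazur's theorem on closed convex hulls of compact sets: \<open>Q\<close> lies in the closed convex
  set \<open>?C\<close> of all points within \<open>d\<close> of the convex hull of a finite \<open>d\<close>-net, that hull is compact,
  and the mean of \<open>f\<close> stays in \<open>?C\<close>.
\<close>

lemma compact_closure_integrals:
  fixes Q :: "'a::banach set" and a b :: real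
  assumes Q: "compact (closure Q)" and "a < b"
  shows "compact (closure {i. \<exists>f. (f has_integral i) {a..b} \<and> f ` {a..b} \<subseteq> Q})"
proof (rule compact_closure_if_near_compact)
  fix e :: real assume "e > 0"
  \<comment> \<open>The mean is within \<open>d\<close> of the hull, so the integral is within \<open>(b - a) * d = e / 2\<close> of the scaled hull.\<close>
  define d where "d = e / (2 * (b - a))"
  have d: "d > 0" using \<open>e > 0\<close> \<open>a < b\<close> by (simp add: d_def)
  then obtain F where F: "finite F" "\<forall>q\<in>Q. \<exists>z\<in>F. dist z q < d"
    using Q unfolding compact_closure_iff_finite_net by blast
  let ?H = "convex hull F"
  let ?C = "\<Union>u\<in>?H. \<Union>v\<in>cball 0 d. {u + v}"
  have H: "compact ?H" by (rule finite_imp_compact_convex_hull[OF F(1)])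
  have clos: "closed ?C" by (rule compact_closed_sums[OF H closed_cball])
  have conv: "convex ?C" by (intro convex_sums convex_convex_hull convex_cball)
  have QC: "q \<in> ?C" if "q \<in> Q" for q
  proof -
    obtain z where z: "z \<in> F" "dist z q < d" using F(2) \<open>q \<in> Q\<close> by blast
    have "z \<in> ?H" using z(1) by (rule hull_inc)
    moreover have "q - z \<in> cball 0 d" using z(2) by (simp add: dist_norm norm_minus_commute)
    moreover have "q = z + (q - z)" by simp
    ultimately show ?thesis by (intro UN_I[of z] UN_I[of "q - z"]) auto
  qed
  show "\<exists>C. compact C \<and> (\<forall>i\<in>{i. \<exists>f. (f has_integral i) {a..b} \<and> f ` {a..b} \<subseteq> Q}. \<exists>c\<in>C. dist c i < e)"
  proof (intro exI conjI ballI)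
    show "compact ((\<lambda>u. (b - a) *\<^sub>R u) ` ?H)" by (rule compact_scaling[OF H])
    fix i assume "i \<in> {i. \<exists>f. (f has_integral i) {a..b} \<and> f ` {a..b} \<subseteq> Q}"
    then obtain f where f: "(f has_integral i) {a..b}" "f ` {a..b} \<subseteq> Q" by blast
    have "i /\<^sub>R (b - a) \<in> ?C"
      using f(2) by (intro has_integral_mean_in_convex[OF f(1) \<open>a < b\<close> clos conv] QC) blast
    then obtain u v where uv: "u \<in> ?H" "norm v \<le> d" "i /\<^sub>R (b - a) = u + v" by auto
    have "i = (b - a) *\<^sub>R (i /\<^sub>R (b - a))" using \<open>a < b\<close> by simp
    then have "i - (b - a) *\<^sub>R u = (b - a) *\<^sub>R v"
      unfolding uv(3) by (simp add: algebra_simps)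
    then have "dist ((b - a) *\<^sub>R u) i = (b - a) * norm v"
      using \<open>a < b\<close> by (metis abs_of_pos diff_gt_0_iff_gt dist_commute dist_norm norm_scaleR)
    also have "\<dots> \<le> (b - a) * d" using uv \<open>a < b\<close> by (intro mult_left_mono) auto
    also have "\<dots> = e / 2" using \<open>a < b\<close> by (simp add: d_def field_simps)
    also have "\<dots> < e" using \<open>e > 0\<close> by simp
    finally show "\<exists>c\<in>(\<lambda>u. (b - a) *\<^sub>R u) ` ?H. dist c i < e" using uv(1) by blast
  qed
qed

section \<open>Baire category\<close>

lemma Baire_dense_INT:
  fixes G :: "nat \<Rightarrow> 'a::complete_space set"
  assumes "\<And>n. open (G n)" "\<And>n. closure (G n) = UNIV"
  shows "closure (\<Inter>n. G n) = UNIV"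
proof -
  have "Met_TC.mtopology closure_of \<Inter>(range G) = UNIV"
  proof (rule Met_TC.metric_Baire_category)
    show "Met_TC.mcomplete TYPE('a)"
      by (simp add: Met_TC.mcomplete_def Cauchy_convergent complete_UNIV flip: convergent_def)
    fix U assume "U \<in> range G"
    then obtain n where "U = G n" by blast
    then show "openin Met_TC.mtopology U \<and> Met_TC.mtopology closure_of U = UNIV"
      using assms[of n] by simp
  qed simp
  then show ?thesis by simp
qed

text \<open>
  Pointwise boundedness says that the open sets \<open>U n\<close> where some \<open>f \<in> \<F>\<close> exceeds \<open>n\<close> have empty
  intersection. By Baire some \<open>U n\<close> misses a ball, and a common bound on one ball rescales to a
  common bound on the operator norms.
\<close>

lemma uniform_boundedness_principle:
  fixes \<F> :: "('a::banach \<Rightarrow> 'b::real_normed_vector) set"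
  assumes lin: "\<And>f. f \<in> \<F> \<Longrightarrow> bounded_linear f"
    and bdd: "\<And>x. bounded ((\<lambda>f. f x) ` \<F>)"
  obtains M where "M > 0" "\<And>f x. f \<in> \<F> \<Longrightarrow> norm (f x) \<le> M * norm x"
proof -
  define U where "U n = (\<Union>f\<in>\<F>. {x. norm (f x) > real n})" for n :: nat
  have "open (U n)" for n
    unfolding U_def
  proof (intro open_UN ballI)
    fix f assume "f \<in> \<F>"
    then have "continuous_on UNIV f" by (intro linear_continuous_on lin)
    then show "open {x. norm (f x) > real n}"
      by (intro open_Collect_less continuous_on_const continuous_on_norm)
  qed
  moreover have "(\<Inter>n. U n) = {}"
  proof -
    have "\<exists>n. x \<notin> U n" for x
    proof -
      obtain B where B: "\<And>f. f \<in> \<F> \<Longrightarrow> norm (f x) \<le> B"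
        using bdd[of x] unfolding bounded_iff by auto
      obtain n where "B \<le> real n" using real_arch_simple by blast
      then have "x \<notin> U n" using B unfolding U_def by force
      then show ?thesis by blast
    qed
    then show ?thesis by blast
  qed
  ultimately obtain n where n: "closure (U n) \<noteq> UNIV"
    using Baire_dense_INT[of U] by auto
  then obtain c where "c \<in> - closure (U n)" by blast
  then obtain r where r: "r > 0" "cball c r \<subseteq> - closure (U n)"
    using open_contains_cball[of "- closure (U n)"] by (auto simp: open_Compl)
  have near: "norm (f y) \<le> real n" if "f \<in> \<F>" "dist c y \<le> r" for f y
  proof -
    have "y \<notin> U n" using r(2) that(2) closure_subset by fastforce
    then show ?thesis using that(1) by (auto simp: U_def)
  qed
  show thesis
  proof (rule that[of "2 * (real n + 1) / r"])
    show "2 * (real n + 1) / r > 0" using r(1) by (simp add: field_simps)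
    fix f and x :: 'a assume f: "f \<in> \<F>"
    interpret f: bounded_linear f by (rule lin[OF f])
    show "norm (f x) \<le> 2 * (real n + 1) / r * norm x"
    proof (cases "x = 0")
      case True
      then show ?thesis by (simp add: f.zero)
    next
      case False
      let ?y = "c + (r / norm x) *\<^sub>R x"
      have "(r / norm x) *\<^sub>R f x = f ?y - f c" by (simp add: f.add f.scaleR)
      then have "(r / norm x) * norm (f x) = norm (f ?y - f c)"
        using r(1) by (metis abs_of_nonneg divide_nonneg_nonneg less_imp_le norm_ge_zero norm_scaleR)
      also have "\<dots> \<le> norm (f ?y) + norm (f c)" by (rule norm_triangle_ineq4)
      also have "\<dots> \<le> real n + real n"
        using f r(1) False by (intro add_mono near) (auto simp: dist_norm)
      also have "\<dots> \<le> 2 * (real n + 1)" by simp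
      finally show ?thesis using False r(1) by (simp add: field_simps)
    qed
  qed
qed

section \<open>Mild solutions as compact perturbations of the semigroup\<close>

text \<open>
  The orbits over \<open>[0,t]\<close> of a finite net of \<open>Q\<close> form a compact set, and by uniform boundedness of
  \<open>T\<close> on \<open>[0,t]\<close> it approximates the orbits of all points of \<open>Q\<close>.
\<close>

lemma compact_closure_semigroup_orbits:
  assumes T: "C0_semigroup T" and Q: "compact (closure Q)"
  shows "compact (closure {T s q | s q. s \<in> {0..t} \<and> q \<in> Q})"
proof (rule compact_closure_if_near_compact)
  fix e :: real assume "e > 0"
  have lin: "bounded_linear (T s)" if "s \<ge> 0" for s
    using T that by (auto simp: C0_semigroup_def bounded_clinear_def)
  have orbit: "compact ((\<lambda>s. T s x) ` {0..t})" for x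
  proof (rule compact_continuous_image)
    have "continuous_on {0..} (\<lambda>s. T s x)" using T by (simp add: C0_semigroup_def)
    then show "continuous_on {0..t} (\<lambda>s. T s x)" by (rule continuous_on_subset) auto
  qed simp
  obtain M where M: "M > 0" "\<And>s x. s \<in> {0..t} \<Longrightarrow> norm (T s x) \<le> M * norm x"
  proof (rule uniform_boundedness_principle[of "T ` {0..t}"])
    show "bounded ((\<lambda>f. f x) ` T ` {0..t})" for x
      using compact_imp_bounded[OF orbit[of x]] by (simp add: image_image)
  qed (use lin in auto)
  obtain F where F: "finite F" "\<forall>q\<in>Q. \<exists>z\<in>F. dist z q < e / M"
    using Q \<open>e > 0\<close> M(1) unfolding compact_closure_iff_finite_net by (meson divide_pos_pos)
  show "\<exists>C. compact C \<and> (\<forall>p\<in>{T s q | s q. s \<in> {0..t} \<and> q \<in> Q}. \<exists>c\<in>C. dist c p < e)"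
  proof (intro exI conjI ballI)
    show "compact (\<Union>z\<in>F. (\<lambda>s. T s z) ` {0..t})" using F(1) orbit by (intro compact_UN) auto
    fix p assume "p \<in> {T s q | s q. s \<in> {0..t} \<and> q \<in> Q}"
    then obtain s q where p: "p = T s q" "s \<in> {0..t}" "q \<in> Q" by blast
    obtain z where z: "z \<in> F" "dist z q < e / M" using F(2) p(3) by blast
    have "dist (T s z) p = norm (T s (z - q))"
      using p by (simp add: dist_norm linear_diff[OF bounded_linear.linear[OF lin]])
    also have "\<dots> \<le> M * norm (z - q)" by (rule M(2)[OF p(2)])
    also have "\<dots> < e" using z(2) M(1) by (simp add: dist_norm field_simps)
    finally show "\<exists>c\<in>\<Union>z\<in>F. (\<lambda>s. T s z) ` {0..t}. dist c p < e" using z(1) p(2) by blast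
  qed
qed

lemma compact_closure_mild_solution_minus_semigroup:
  assumes T: "C0_semigroup T" and K: "collectively_compact K"
    and sol: "\<And>y. mild_solution T K y (\<lambda>t. x t y)"
    and bdd: "bounded {x s y | s y. 0 \<le> s \<and> s \<le> t \<and> y \<in> B}"
    and "t > 0"
  shows "compact (closure ((\<lambda>y. x t y - T t y) ` B))"
proof -
  define B' where "B' = {x s y | s y. 0 \<le> s \<and> s \<le> t \<and> y \<in> B}"
  define Q where "Q = {T s q | s q. s \<in> {0..t} \<and> q \<in> (\<lambda>(t, x). K t x) ` ({0..t} \<times> B')}"
  have "compact (closure ((\<lambda>(t, x). K t x) ` ({0..t} \<times> B')))"
    using K bdd \<open>t > 0\<close> unfolding collectively_compact_def B'_def by simp
  then have "compact (closure Q)"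
    unfolding Q_def by (rule compact_closure_semigroup_orbits[OF T])
  then have comp: "compact (closure {i. \<exists>f. (f has_integral i) {0..t} \<and> f ` {0..t} \<subseteq> Q})"
    by (rule compact_closure_integrals[OF _ \<open>t > 0\<close>])
  have "(\<lambda>y. x t y - T t y) ` B \<subseteq> {i. \<exists>f. (f has_integral i) {0..t} \<and> f ` {0..t} \<subseteq> Q}"
  proof (intro image_subsetI CollectI exI conjI)
    fix y assume y: "y \<in> B"
    show "((\<lambda>s. T (t - s) (K s (x s y))) has_integral (x t y - T t y)) {0..t}"
      using sol[of y] \<open>t > 0\<close> by (simp add: mild_solution_def)
    show "T (t - s) (K s (x s y)) \<in> Q" if "s \<in> {0..t}" for s
    proof -
      have "x s y \<in> B'" using that y by (auto simp: B'_def)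
      then have "K s (x s y) \<in> (\<lambda>(t, x). K t x) ` ({0..t} \<times> B')" using that by force
      moreover have "t - s \<in> {0..t}" using that by simp
      ultimately show ?thesis unfolding Q_def by blast
    qed
  qed
  note subset = closure_mono[OF this]
  have "compact (closure ((\<lambda>y. x t y - T t y) ` B) \<inter>
      closure {i. \<exists>f. (f has_integral i) {0..t} \<and> f ` {0..t} \<subseteq> Q})"
    by (rule closed_Int_compact[OF closed_closure comp])
  then show ?thesis
    using subset by (simp add: inf.absorb1)
qed

text \<open>
  If \<open>R y\<close> is within \<open>d\<close> of \<open>z\<close>, then \<open>S y\<close> is within \<open>b + d\<close> of \<open>- z\<close>. Hence \<open>S\<close> maps
  \<open>cball c e\<close>, and after translation and scaling the unit ball, into finitely many balls.
\<close>

lemma mu_norm_le_compact_perturbation: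
  fixes S R :: "'a::complex_banach \<Rightarrow> 'a"
  assumes S: "bounded_linear S" and R: "compact (closure (R ` cball c e))" and "e > 0"
    and bound: "\<And>y. y \<in> cball c e \<Longrightarrow> norm (S y + R y) \<le> b"
  shows "e * mu_norm S \<le> 2 * b"
proof -
  interpret S: bounded_linear S by (rule S)
  have "mu_norm S \<le> 2 * ((b + d) / e)" if "d > 0" for d
  proof -
    obtain F where F: "finite F" "\<forall>q\<in>R ` cball c e. \<exists>z\<in>F. dist z q < d"
      using R \<open>d > 0\<close> unfolding compact_closure_iff_finite_net by blast
    show ?thesis
    proof (rule mu_norm_le_covering[OF S])
      show "finite ((\<lambda>z. (- z - S c) /\<^sub>R e) ` F)" using F(1) by simp
      fix u :: 'a assume u: "norm u \<le> 1"
      let ?y = "c + e *\<^sub>R u"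
      have y: "?y \<in> cball c e" using u \<open>e > 0\<close> by (simp add: dist_norm)
      then obtain z where z: "z \<in> F" "dist z (R ?y) < d" using F(2) by blast
      have "e *\<^sub>R (S u - (- z - S c) /\<^sub>R e) = (S ?y + R ?y) + (z - R ?y)"
        using \<open>e > 0\<close> by (simp add: S.add S.scaleR algebra_simps)
      then have "e * norm (S u - (- z - S c) /\<^sub>R e) = norm ((S ?y + R ?y) + (z - R ?y))"
        using \<open>e > 0\<close> by (metis abs_of_pos norm_scaleR)
      also have "\<dots> \<le> norm (S ?y + R ?y) + norm (z - R ?y)" by (rule norm_triangle_ineq)
      also have "\<dots> \<le> b + d" using bound[OF y] z(2) by (simp add: dist_norm)
      finally show "\<exists>z\<in>(\<lambda>z. (- z - S c) /\<^sub>R e) ` F. norm (S u - z) \<le> (b + d) / e"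
        using \<open>e > 0\<close> z(1) by (intro bexI[of _ "(- z - S c) /\<^sub>R e"]) (auto simp: field_simps)
    qed
  qed
  then have le: "e * mu_norm S \<le> 2 * b + 2 * d" if "d > 0" for d
    using that \<open>e > 0\<close> by (simp add: pos_le_divide_eq mult.commute)
  show ?thesis
  proof (rule field_le_epsilon)
    fix d :: real assume "d > 0"
    then show "e * mu_norm S \<le> 2 * b + d" using le[of "d / 2"] by simp
  qed
qed

section \<open>Residuality of the set of slowly decaying initial values\<close>

theorem theorem7p4:
  fixes T :: "real \<Rightarrow> 'a::complex_banach \<Rightarrow> 'a"
    and A :: "('a \<times> 'a) set"
    and K :: "real \<Rightarrow> 'a \<Rightarrow> 'a"
    and x :: "real \<Rightarrow> 'a \<Rightarrow> 'a"
    and a :: "real \<Rightarrow> real"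
    and L :: "real set"
  assumes "infinite_dimensional TYPE('a)"
    and "C0_semigroup T"
    and "A = generator T"
    and "collectively_compact K"
    and "separately_continuous K"
    and "\<And>x\<^sub>0. mild_solution T K x\<^sub>0 (\<lambda>t. x t x\<^sub>0)"
    and "\<And>x\<^sub>0 u t. mild_solution T K x\<^sub>0 u \<Longrightarrow> t \<ge> 0 \<Longrightarrow> u t = x t x\<^sub>0"
    and "separately_continuous x"
    and "\<And>B t\<^sub>0. bounded B \<Longrightarrow> t\<^sub>0 > 0 \<Longrightarrow> bounded {x t x\<^sub>0 | t x\<^sub>0. 0 \<le> t \<and> t \<le> t\<^sub>0 \<and> x\<^sub>0 \<in> B}"
    and "\<And>t. t \<ge> 0 \<Longrightarrow> a t \<ge> 0"
    and "antimono_on {0..} a"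
    and "(a \<longlongrightarrow> 0) at_top"
    and "L \<subseteq> {0..}"
    and "\<not> bounded L"
  shows "residual {y. infinite {t\<in>L. norm (x t y) \<ge> a t * mu_norm (T t)}}"
proof (cases "finite {t\<in>L. mu_norm (T t) = 0}")
  case False
  have "infinite {t\<in>L. norm (x t y) \<ge> a t * mu_norm (T t)}" for y
    by (rule infinite_super[OF _ False]) auto
  moreover have "gdelta (UNIV :: 'a set)"
    using gdelta.intros[of "\<lambda>_. UNIV :: 'a set"] by simp
  ultimately show ?thesis
    unfolding residual_def by (intro exI[of _ UNIV]) simp
next
  case True
  have lin: "bounded_linear (T t)" if "t \<ge> 0" for t
    using assms(2) that by (auto simp: C0_semigroup_def bounded_clinear_def)
  define V where "V t = {y. norm (x t y) > a t * mu_norm (T t)}" for t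
  define G where "G n = (\<Union>t\<in>{t\<in>L. t > real n}. V t)" for n :: nat
  have "open (G n)" for n
    unfolding G_def
  proof (intro open_UN ballI)
    fix t assume "t \<in> {t\<in>L. t > real n}"
    then have "continuous_on UNIV (x t)" using assms(8) by (simp add: separately_continuous_def)
    then show "open (V t)" unfolding V_def by (intro open_Collect_less continuous_on_const continuous_on_norm)
  qed
  moreover have "closure (G n) = UNIV" for n
  proof -
    have "\<exists>y\<in>G n. dist y c < e" if "e > 0" for c e
    proof -
      \<comment> \<open>On a closed ball of radius \<open>e / 2\<close> the estimate \<open>e / 2 * \<mu> \<le> 2 * (a t * \<mu>)\<close> fails once \<open>a t < e / 4\<close>.\<close>
      have "eventually (\<lambda>t. a t < e / 4) at_top"
        using assms(12) \<open>e > 0\<close> by (intro order_tendstoD) auto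
      then obtain N where N: "\<And>t. t \<ge> N \<Longrightarrow> a t < e / 4"
        unfolding eventually_at_top_linorder by blast
      obtain N' where N': "\<And>t. t \<in> L \<Longrightarrow> mu_norm (T t) = 0 \<Longrightarrow> t \<le> N'"
        using bdd_above_finite[OF True] unfolding bdd_above_def by blast
      have "\<not> L \<subseteq> {0..max (real n) (max N N')}"
        using assms(14) bounded_subset bounded_closed_interval by blast
      then obtain t where t: "t \<in> L" "t > max (real n) (max N N')"
        using assms(13) by fastforce
      have "t > 0" using t(2) by (auto intro: le_less_trans[of 0 "real n"])
      have mu: "mu_norm (T t) > 0"
        using N'[OF t(1)] t(2) mu_norm_nonneg[OF lin[of t]] \<open>t > 0\<close> by fastforce
      have comp: "compact (closure ((\<lambda>y. x t y - T t y) ` cball c (e / 2)))"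
        using assms(9)[OF bounded_cball \<open>t > 0\<close>]
        by (rule compact_closure_mild_solution_minus_semigroup[OF assms(2,4,6) _ \<open>t > 0\<close>])
      have "\<exists>y\<in>cball c (e / 2). y \<in> V t"
      proof (rule ccontr)
        assume "\<not> (\<exists>y\<in>cball c (e / 2). y \<in> V t)"
        then have "norm (T t y + (x t y - T t y)) \<le> a t * mu_norm (T t)" if "y \<in> cball c (e / 2)" for y
          using that by (auto simp: V_def not_less)
        then have "e / 2 * mu_norm (T t) \<le> 2 * (a t * mu_norm (T t))"
          using \<open>e > 0\<close> \<open>t > 0\<close> by (intro mu_norm_le_compact_perturbation[OF lin comp]) auto
        then have "e / 4 \<le> a t" using mu by simp
        then show False using N[of t] t(2) by simp
      qed
      then obtain y where y: "y \<in> cball c (e / 2)" "y \<in> V t" by blast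
      then show ?thesis
        using t \<open>e > 0\<close> by (intro bexI[of _ y]) (auto simp: G_def dist_commute)
    qed
    then show ?thesis by (auto simp: closure_approachable)
  qed
  ultimately have "closure (\<Inter>n. G n) = UNIV" by (rule Baire_dense_INT)
  moreover have "gdelta (\<Inter>n. G n)" using \<open>\<And>n. open (G n)\<close> by (rule gdelta.intros)
  moreover have "infinite {t\<in>L. norm (x t y) \<ge> a t * mu_norm (T t)}" if "y \<in> (\<Inter>n. G n)" for y
  proof
    assume "finite {t\<in>L. norm (x t y) \<ge> a t * mu_norm (T t)}"
    then obtain b where b: "\<And>t. t \<in> L \<Longrightarrow> norm (x t y) \<ge> a t * mu_norm (T t) \<Longrightarrow> t \<le> b"
      using bdd_above_finite unfolding bdd_above_def by blast
    obtain n where "b \<le> real n" using real_arch_simple by blast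
    moreover obtain t where "t \<in> L" "t > real n" "y \<in> V t"
      using \<open>y \<in> (\<Inter>n. G n)\<close> unfolding G_def by blast
    ultimately show False using b[of t] by (simp add: V_def)
  qed
  ultimately show ?thesis
    unfolding residual_def by (intro exI[of _ "\<Inter>n. G n"]) blast
qed

end
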